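(* Let $H$ be a real Hilbert space, let $\rho>0$, $L>0$, $\beta>0$, $\theta\ge 0$, let $f,g:H\to(-\infty,+\infty]$ be proper, lower semicontinuous and $\rho$-strongly convex, and let $h:H\to\mathbb{R}$ be a smooth convex function whose gradient $\nabla h$ is Lipschitz continuous with constant $L$. Assume that the set $\Omega$ of stationary points of $f+g-h$ is nonempty, that $2\rho>L$, and that $(\kappa_n)_{n\ge 0}$ is a real sequence with $0<a\le\kappa_n\le b<2$ for all $n$, for some constants $a,b$. Let $x_0,v_0\in H$ be arbitrary and define, for $n\ge 0$, $$ \begin{aligned} u_n&=\frac{1}{1+\theta}x_n+\frac{\theta}{1+\theta}v_n,\\ y_n&=\operatorname*{argmin}_{v\in H}\Big\{f(v)+\frac{1}{2\beta}\|v-u_n\|^2\Big\},\\ z_n&=\operatorname*{argmin}_{v\in H}\Big\{g(v)+\frac{1}{2\beta}\|v-(2y_n-u_n+\beta\nabla h(y_n))\|^2\Big\},\\ x_{n+1}&=u_n+\kappa_n(z_n-y_n),\\ v_{n+1}&=\frac{1}{1+\theta}x_{n+1}+\frac{\theta}{1+\theta}v_n. \end{aligned} $$ Then the sequence $\{x_n\}$ converges weakly to a point in $\Gamma_\beta$.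
   Context: A function $f:H\to(-\infty,+\infty]$ is $\rho$-strongly convex if $f-\frac{\rho}{2}\|\cdot\|^2$ is convex. $\partial f$ denotes the convex subdifferential: $\partial f(x)=\{u\in H: f(z)\ge f(x)+\langle z-x,u\rangle\ \forall z\in H\}$. A point $x\in H$ is a stationary point of $p=f+g-h$ if $0\in\partial f(x)+\partial g(x)-\nabla h(x)$; $\Omega$ denotes the set of all stationary points. For $\beta>0$ and a proper, lower semicontinuous, convex function $f$, $\operatorname{prox}_{\beta f}(x)=\operatorname*{argmin}_{u\in H}\{f(u)+\frac{1}{2\beta}\|u-x\|^2\}$ (the unique minimizer). The set $\Gamma_\beta$ is $$\Gamma_\beta=\{y\in H:\ \text{there exists } x\in\Omega \text{ with } \operatorname{prox}_{\beta f}(y)=x \text{ and } \operatorname{prox}_{\beta g}(2x-y+\beta\nabla h(x))=x\}.$$ *)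

theory Defs
  imports "HOL-Analysis.Analysis"
begin

text \<open>
  A real Hilbert space is a type of sort \<open>{real_inner, complete_space}\<close>. Functions into
  $(-\infty, +\infty]$ have codomain \<^typ>\<open>ereal\<close>; the value \<open>-\<infinity>\<close> is excluded by \<open>proper_fun\<close>.
\<close>

definition proper_fun :: "('a \<Rightarrow> ereal) \<Rightarrow> bool" where
  "proper_fun f \<longleftrightarrow> (\<forall>x. f x \<noteq> -\<infinity>) \<and> (\<exists>x. f x \<noteq> \<infinity>)"

definition lower_semicontinuous :: "('a::topological_space \<Rightarrow> ereal) \<Rightarrow> bool" where
  "lower_semicontinuous f \<longleftrightarrow> (\<forall>x. f x \<le> Liminf (at x) f)"

text \<open>
  The library's \<open>convex_on\<close> is restricted to real-valued functions. Since \<open>0 * \<infinity> = 0\<close> in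
  \<^typ>\<open>ereal\<close>, the endpoint cases of the inequality below are trivial.
\<close>

definition convex_ereal :: "('a::real_vector \<Rightarrow> ereal) \<Rightarrow> bool" where
  "convex_ereal f \<longleftrightarrow>
    (\<forall>x y. \<forall>s\<ge>0. \<forall>t\<ge>0. s + t = 1 \<longrightarrow>
      f (s *\<^sub>R x + t *\<^sub>R y) \<le> ereal s * f x + ereal t * f y)"

definition strongly_convex_ereal :: "real \<Rightarrow> ('a::real_normed_vector \<Rightarrow> ereal) \<Rightarrow> bool" where
  "strongly_convex_ereal \<rho> f \<longleftrightarrow> convex_ereal (\<lambda>x. f x - ereal (\<rho> / 2 * (norm x)\<^sup>2))"

definition subdifferential :: "('a::real_inner \<Rightarrow> ereal) \<Rightarrow> 'a \<Rightarrow> 'a set" where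
  "subdifferential f x = {u. \<forall>z. f z \<ge> f x + ereal (inner (z - x) u)}"

text \<open>
  In the next two definitions the third function argument \<open>dh\<close> is the gradient of the smooth
  function $h$, not $h$ itself.
\<close>

definition stationary_points ::
    "('a::real_inner \<Rightarrow> ereal) \<Rightarrow> ('a \<Rightarrow> ereal) \<Rightarrow> ('a \<Rightarrow> 'a) \<Rightarrow> 'a set" where
  "stationary_points f g dh =
    {x. 0 \<in> {a + b - dh x | a b. a \<in> subdifferential f x \<and> b \<in> subdifferential g x}}"

definition prox :: "real \<Rightarrow> ('a::real_normed_vector \<Rightarrow> ereal) \<Rightarrow> 'a \<Rightarrow> 'a" where
  "prox \<beta> f x = (ARG_MIN (\<lambda>u. f u + ereal (1 / (2 * \<beta>) * (norm (u - x))\<^sup>2)) u. True)"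

definition Gamma_set ::
    "real \<Rightarrow> ('a::real_inner \<Rightarrow> ereal) \<Rightarrow> ('a \<Rightarrow> ereal) \<Rightarrow> ('a \<Rightarrow> 'a) \<Rightarrow> 'a set" where
  "Gamma_set \<beta> f g dh =
    {y. \<exists>x\<in>stationary_points f g dh.
          prox \<beta> f y = x \<and> prox \<beta> g (2 *\<^sub>R x - y + \<beta> *\<^sub>R dh x) = x}"

definition weakly_converges_to :: "(nat \<Rightarrow> 'a::real_inner) \<Rightarrow> 'a \<Rightarrow> bool" where
  "weakly_converges_to x p \<longleftrightarrow> (\<forall>w. (\<lambda>n. inner (x n) w) \<longlonglongrightarrow> inner p w)"

end

theory Submission
  imports Defs
begin

text \<open>
  The iteration is a relaxed fixed-point iteration, averaged with the auxiliary sequence \<open>v\<close>, of the operator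
  $T w = w + \mathrm{prox}_{\beta g}(2 P w - w + \beta \nabla h(P w)) - P w$ with $P = \mathrm{prox}_{\beta f}$,
  whose fixed point set is $\Gamma_\beta$. Strong monotonicity of $\partial f$ and $\partial g$ absorbs the
  Lipschitz term because $L \le 2\rho$, so $T$ is firmly nonexpansive. For every fixed point $p$, with
  $t = \theta / (1 + \theta)$, the quantity $(1 - t)^2 \|x_n - p\|^2 + t \|v_n - p\|^2$ decreases, which gives
  $u_n - T u_n \to 0$, $u_n - x_n \to 0$ and convergence of $\|u_n - p\|$.

  Weak convergence is obtained without weak compactness: the asymptotic center of $u$ along any filter finer
  than \<open>sequentially\<close> is a fixed point of $T$, and convergence of $\|u_n - p\|$ forces all these centers to coincide.
\<close>

section \<open>Strongly convex functions: quadratic growth and existence of minimizers\<close>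

text \<open>
  The real function \<open>F\<close> on its effective domain \<open>D\<close> stands for the extended-valued function that is \<open>\<infinity>\<close>
  outside \<open>D\<close>; the last conjunct is its lower semicontinuity.
\<close>

definition closed_strongly_convex :: "real \<Rightarrow> 'a::real_inner set \<Rightarrow> ('a \<Rightarrow> real) \<Rightarrow> bool" where
  "closed_strongly_convex m D F \<longleftrightarrow> D \<noteq> {} \<and>
    (\<forall>x\<in>D. \<forall>y\<in>D. \<forall>t. 0 \<le> t \<and> t \<le> 1 \<longrightarrow>
      (1 - t) *\<^sub>R x + t *\<^sub>R y \<in> D \<and>
      F ((1 - t) *\<^sub>R x + t *\<^sub>R y) \<le> (1 - t) * F x + t * F y - m / 2 * (t * (1 - t) * (norm (x - y))\<^sup>2)) \<and>
    (\<forall>X x c C. X \<longlonglongrightarrow> x \<longrightarrow> c \<longlonglongrightarrow> C \<longrightarrow> (\<forall>n. X n \<in> D \<and> F (X n) \<le> c n) \<longrightarrow> x \<in> D \<and> F x \<le> C)"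

lemma closed_strongly_convexI:
  assumes "D \<noteq> {}"
    and "\<And>x y t. x \<in> D \<Longrightarrow> y \<in> D \<Longrightarrow> 0 \<le> t \<Longrightarrow> t \<le> 1 \<Longrightarrow> (1 - t) *\<^sub>R x + t *\<^sub>R y \<in> D"
    and "\<And>x y t. x \<in> D \<Longrightarrow> y \<in> D \<Longrightarrow> 0 \<le> t \<Longrightarrow> t \<le> 1 \<Longrightarrow>
      F ((1 - t) *\<^sub>R x + t *\<^sub>R y) \<le> (1 - t) * F x + t * F y - m / 2 * (t * (1 - t) * (norm (x - y))\<^sup>2)"
    and "\<And>X x c C. X \<longlonglongrightarrow> x \<Longrightarrow> c \<longlonglongrightarrow> C \<Longrightarrow> (\<And>n. X n \<in> D) \<Longrightarrow> (\<And>n. F (X n) \<le> c n) \<Longrightarrow>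
      x \<in> D \<and> F x \<le> C"
  shows "closed_strongly_convex m D F"
  unfolding closed_strongly_convex_def
proof (intro conjI ballI allI impI)
  show "D \<noteq> {}" by (rule assms(1))
qed (use assms(2-4) in simp_all)

lemma closed_strongly_convexD:
  assumes "closed_strongly_convex m D F"
  shows "D \<noteq> {}"
    and "\<And>x y t. x \<in> D \<Longrightarrow> y \<in> D \<Longrightarrow> 0 \<le> t \<Longrightarrow> t \<le> 1 \<Longrightarrow> (1 - t) *\<^sub>R x + t *\<^sub>R y \<in> D"
    and "\<And>x y t. x \<in> D \<Longrightarrow> y \<in> D \<Longrightarrow> 0 \<le> t \<Longrightarrow> t \<le> 1 \<Longrightarrow>
      F ((1 - t) *\<^sub>R x + t *\<^sub>R y) \<le> (1 - t) * F x + t * F y - m / 2 * (t * (1 - t) * (norm (x - y))\<^sup>2)"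
    and "\<And>X x c C. X \<longlonglongrightarrow> x \<Longrightarrow> c \<longlonglongrightarrow> C \<Longrightarrow> (\<And>n. X n \<in> D) \<Longrightarrow> (\<And>n. F (X n) \<le> c n) \<Longrightarrow> x \<in> D"
    and "\<And>X x c C. X \<longlonglongrightarrow> x \<Longrightarrow> c \<longlonglongrightarrow> C \<Longrightarrow> (\<And>n. X n \<in> D) \<Longrightarrow> (\<And>n. F (X n) \<le> c n) \<Longrightarrow> F x \<le> C"
  using assms unfolding closed_strongly_convex_def by simp_all

lemma norm_convex_combination:
  fixes x y :: "'a::real_inner"
  shows "(norm ((1 - t) *\<^sub>R x + t *\<^sub>R y))\<^sup>2
    = (1 - t) * (norm x)\<^sup>2 + t * (norm y)\<^sup>2 - t * (1 - t) * (norm (x - y))\<^sup>2"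
  unfolding power2_norm_eq_inner
  by (simp add: inner_commute algebra_simps)

text \<open>\<open>norm_convex_combination\<close> is an identity, so the quadratic raises the
  modulus by exactly \<open>2 * k\<close>, and the linear term leaves it unchanged. The quadratic
  builds proximal objectives; the linear tilt turns a subgradient inequality into
  minimality.\<close>

lemma closed_strongly_convex_add_quadratic:
  fixes F :: "'a::real_inner \<Rightarrow> real"
  assumes "closed_strongly_convex m D F"
  shows "closed_strongly_convex (m + 2 * k) D (\<lambda>z. F z + k * (norm (z - w))\<^sup>2 + inner z e)"
proof (rule closed_strongly_convexI)
  note A = closed_strongly_convexD[OF assms]
  show "D \<noteq> {}" by (rule A)
  fix x y :: 'a and t :: real
  assume xy: "x \<in> D" "y \<in> D" "0 \<le> t" "t \<le> 1"
  show "(1 - t) *\<^sub>R x + t *\<^sub>R y \<in> D" by (rule A(2)[OF xy])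
  have "((1 - t) *\<^sub>R x + t *\<^sub>R y) - w = (1 - t) *\<^sub>R (x - w) + t *\<^sub>R (y - w)"
    by (simp add: algebra_simps)
  then have n: "(norm (((1 - t) *\<^sub>R x + t *\<^sub>R y) - w))\<^sup>2
    = (1 - t) * (norm (x - w))\<^sup>2 + t * (norm (y - w))\<^sup>2 - t * (1 - t) * (norm (x - y))\<^sup>2"
    by (simp only: norm_convex_combination) simp
  show "F ((1 - t) *\<^sub>R x + t *\<^sub>R y) + k * (norm ((1 - t) *\<^sub>R x + t *\<^sub>R y - w))\<^sup>2
      + inner ((1 - t) *\<^sub>R x + t *\<^sub>R y) e
    \<le> (1 - t) * (F x + k * (norm (x - w))\<^sup>2 + inner x e) + t * (F y + k * (norm (y - w))\<^sup>2 + inner y e)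
      - (m + 2 * k) / 2 * (t * (1 - t) * (norm (x - y))\<^sup>2)"
  proof -
    have i: "inner ((1 - t) *\<^sub>R x + t *\<^sub>R y) e = (1 - t) * inner x e + t * inner y e"
      by (simp add: inner_add_left)
    show ?thesis using A(3)[OF xy] unfolding n i by (simp add: field_simps)
  qed
next
  note A = closed_strongly_convexD[OF assms]
  fix X :: "nat \<Rightarrow> 'a" and x c C
  assume l: "X \<longlonglongrightarrow> x" "c \<longlonglongrightarrow> (C::real)" and D: "\<And>n. X n \<in> D"
    and le: "\<And>n. F (X n) + k * (norm (X n - w))\<^sup>2 + inner (X n) e \<le> c n"
  let ?c = "\<lambda>n. c n - k * (norm (X n - w))\<^sup>2 - inner (X n) e"
  have c: "?c \<longlonglongrightarrow> C - k * (norm (x - w))\<^sup>2 - inner x e"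
    by (intro tendsto_intros l)
  have F: "F (X n) \<le> ?c n" for n using le[of n] by simp
  show "x \<in> D \<and> F x + k * (norm (x - w))\<^sup>2 + inner x e \<le> C"
    using A(4)[OF l(1) c D F] A(5)[OF l(1) c D F] by simp
qed

text \<open>Comparing \<open>F x\<close> with the value at a point of the segment from
  \<open>x\<close> to \<open>z\<close> and dividing by the parameter \<open>t\<close> leaves the
  factor \<open>1 - t\<close> on the quadratic term; it disappears as \<open>t\<close> tends to
  0.\<close>

lemma strongly_convex_minimizer_growth:
  assumes A: "closed_strongly_convex m D F" and x: "x \<in> D" and z: "z \<in> D"
    and min: "\<And>w. w \<in> D \<Longrightarrow> F x \<le> F w"
  shows "F x + m / 2 * (norm (z - x))\<^sup>2 \<le> F z"
proof -
  have "F x \<le> F z - m / 2 * ((1 - t) * (norm (z - x))\<^sup>2)" if t: "0 < t" "t < 1" for t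
  proof -
    have "F x \<le> (1 - t) * F x + t * F z - m / 2 * (t * (1 - t) * (norm (x - z))\<^sup>2)"
      using min[OF closed_strongly_convexD(2)[OF A x z, of t]] closed_strongly_convexD(3)[OF A x z, of t] t
      by linarith
    then have "t * F x \<le> t * (F z - m / 2 * ((1 - t) * (norm (z - x))\<^sup>2))"
      by (simp add: algebra_simps norm_minus_commute)
    then show ?thesis using t by simp
  qed
  then have ev: "\<forall>\<^sub>F t in at_right 0. F x \<le> F z - m / 2 * ((1 - t) * (norm (z - x))\<^sup>2)"
    by (auto simp: eventually_at_right_field intro!: exI[of _ 1])
  have "((\<lambda>t. F z - m / 2 * ((1 - t) * (norm (z - x))\<^sup>2)) \<longlongrightarrow> F z - m / 2 * ((1 - 0) * (norm (z - x))\<^sup>2))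
    (at_right 0)"
    by (intro tendsto_intros)
  from tendsto_lowerbound[OF this ev] show ?thesis by simp
qed

lemma strongly_convex_bounded_below:
  fixes F :: "'a::real_inner \<Rightarrow> real"
  assumes A: "closed_strongly_convex m D F" and m: "m > 0"
  shows "bdd_below (F ` D)"
proof -
  obtain p where p: "p \<in> D" using closed_strongly_convexD(1)[OF A] by blast
  txt \<open>Lower semicontinuity bounds \<open>F\<close> near \<open>p\<close>; strong convexity along the segment from \<open>p\<close> carries the
    bound to all of \<open>D\<close>, so no affine minorant (Hahn-Banach) is needed.\<close>
  have "\<exists>d>0. \<forall>w\<in>D. norm (w - p) \<le> d \<longrightarrow> F p - 1 \<le> F w"
  proof (rule ccontr)
    assume "\<not> ?thesis"
    then have "\<forall>n. \<exists>w. w \<in> D \<and> norm (w - p) \<le> 1 / real (Suc n) \<and> F w \<le> F p - 1"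
      by (metis less_eq_real_def linorder_not_le of_nat_0_less_iff zero_less_Suc zero_less_divide_1_iff)
    then obtain X where X: "\<And>n. X n \<in> D" "\<And>n. norm (X n - p) \<le> 1 / real (Suc n)" "\<And>n. F (X n) \<le> F p - 1"
      by metis
    have "(\<lambda>n. X n - p) \<longlonglongrightarrow> 0"
      by (rule Lim_null_comparison[OF _ LIMSEQ_inverse_real_of_nat]) (use X(2) in \<open>simp add: inverse_eq_divide\<close>)
    then have "X \<longlonglongrightarrow> p" by (simp add: LIM_zero_iff)
    then have "F p \<le> F p - 1"
      by (rule closed_strongly_convexD(5)[OF A _ tendsto_const X(1,3)])
    then show False by simp
  qed
  then obtain d where d: "d > 0" and near: "\<And>w. w \<in> D \<Longrightarrow> norm (w - p) \<le> d \<Longrightarrow> F p - 1 \<le> F w"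
    by blast
  \<comment> \<open>\<open>K\<close> collects the coefficients linear in \<open>r\<close> of the
    bound obtained below. Completing the square in \<open>r\<close> then costs
    \<open>K\<^sup>2 / (2 * m)\<close>.\<close>
  define K where "K = 1 / d + m / 2 * d"
  have "F p - 1 - K\<^sup>2 / (2 * m) \<le> F w" if w: "w \<in> D" for w
  proof (cases "norm (w - p) \<le> d")
    case True
    have "0 \<le> K\<^sup>2 / (2 * m)" using m by simp
    then show ?thesis using near[OF w True] by linarith
  next
    case False
    define r where "r = norm (w - p)"
    \<comment> \<open>With this \<open>t\<close> the point \<open>?q\<close> lies at distance
      exactly \<open>d\<close> from \<open>p\<close>, where \<open>near\<close> still
      applies.\<close>
    define t where "t = d / r"
    have r: "r > d" "r > 0" using False d unfolding r_def by linarith+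
    have t: "0 < t" "t < 1" using r d unfolding t_def by auto
    let ?q = "(1 - t) *\<^sub>R p + t *\<^sub>R w"
    have "?q - p = t *\<^sub>R (w - p)" by (simp add: algebra_simps)
    then have "norm (?q - p) = t * r" using t by (simp add: r_def)
    then have "norm (?q - p) \<le> d" using r unfolding t_def by simp
    then have "F p - 1 \<le> (1 - t) * F p + t * F w - m / 2 * (t * (1 - t) * r\<^sup>2)"
      using near[of ?q] closed_strongly_convexD(2,3)[OF A p w, of t] t
      by (simp add: r_def norm_minus_commute)
    then have "t * (F p - 1 / t + m / 2 * ((1 - t) * r\<^sup>2)) \<le> t * F w"
      using t by (simp add: algebra_simps)
    then have "F p - 1 / t + m / 2 * ((1 - t) * r\<^sup>2) \<le> F w" using t by simp
    moreover have "1 / t = r / d" using d r by (simp add: t_def)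
    moreover have "(1 - t) * r\<^sup>2 = r\<^sup>2 - d * r" using r by (simp add: t_def power2_eq_square algebra_simps)
    ultimately have "F p - r / d + m / 2 * (r\<^sup>2 - d * r) \<le> F w" by simp
    then have "F p - K * r + m / 2 * r\<^sup>2 \<le> F w" by (simp add: K_def algebra_simps)
    moreover have "m / 2 * r\<^sup>2 - K * r = m / 2 * (r - K / m)\<^sup>2 - K\<^sup>2 / (2 * m)"
      using m by (simp add: power2_eq_square field_simps)
    moreover have "0 \<le> m / 2 * (r - K / m)\<^sup>2" using m by simp
    ultimately show ?thesis by linarith
  qed
  then show ?thesis by (auto intro!: bdd_belowI2)
qed

text \<open>Strong convexity at midpoints makes a minimizing sequence Cauchy, so completeness gives
  a strong limit, and closedness puts it in \<open>D\<close> with value at most the infimum.\<close>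

lemma strongly_convex_minimizer_exists:
  fixes F :: "'a::{real_inner, complete_space} \<Rightarrow> real"
  assumes A: "closed_strongly_convex m D F" and m: "m > 0"
  shows "\<exists>x\<in>D. \<forall>w\<in>D. F x \<le> F w"
proof -
  define I where "I = Inf (F ` D)"
  have bdd: "bdd_below (F ` D)" by (rule strongly_convex_bounded_below[OF A m])
  have I: "I \<le> F w" if "w \<in> D" for w
    unfolding I_def using that bdd by (simp add: cINF_lower)
  have "\<exists>w\<in>D. F w < I + e" if "e > 0" for e
    using cInf_lessD[of "F ` D" "I + e"] closed_strongly_convexD(1)[OF A] that by (auto simp: I_def)
  then have "\<forall>n. \<exists>w. w \<in> D \<and> F w \<le> I + inverse (real (Suc n))"
    by (meson inverse_positive_iff_positive less_eq_real_def of_nat_0_less_iff zero_less_Suc)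
  then obtain X where X: "\<And>n. X n \<in> D" "\<And>n. F (X n) \<le> I + inverse (real (Suc n))" by metis
  have c: "(\<lambda>n. I + inverse (real (Suc n))) \<longlonglongrightarrow> I"
    using tendsto_add[OF tendsto_const LIMSEQ_inverse_real_of_nat, of I] by simp
  \<comment> \<open>The constant is \<open>m / 2 * (t * (1 - t))\<close> at
    \<open>t = 1 / 2\<close>: the value at the midpoint is at least \<open>I\<close>, while the two
    endpoint values exceed \<open>I\<close> by at most
    \<open>inverse (real (Suc N))\<close>.\<close>
  have dist: "m / 8 * (norm (X i - X j))\<^sup>2 \<le> inverse (real (Suc N))" if "i \<ge> N" "j \<ge> N" for i j N
  proof -
    have X': "F (X k) \<le> I + inverse (real (Suc N))" if "k \<ge> N" for k
    proof -
      have "inverse (real (Suc k)) \<le> inverse (real (Suc N))" using that by (intro le_imp_inverse_le) auto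
      then show ?thesis using X(2)[of k] by argo
    qed
    have "I \<le> F (X i) / 2 + F (X j) / 2 - m / 8 * (norm (X i - X j))\<^sup>2"
      using I[OF closed_strongly_convexD(2)[OF A X(1)[of i] X(1)[of j], of "1/2"]]
        closed_strongly_convexD(3)[OF A X(1)[of i] X(1)[of j], of "1/2"] by simp
    then show ?thesis using X'[OF that(1)] X'[OF that(2)] by argo
  qed
  have "Cauchy X"
  proof (rule metric_CauchyI)
    fix e :: real assume e: "0 < e"
    then have "0 < m / 8 * e\<^sup>2" using m by simp
    then obtain N where N: "inverse (real (Suc N)) < m / 8 * e\<^sup>2"
      using reals_Archimedean by blast
    have "dist (X i) (X j) < e" if "i \<ge> N" "j \<ge> N" for i j
    proof -
      have "m / 8 * (norm (X i - X j))\<^sup>2 < m / 8 * e\<^sup>2" using dist[OF that] N by linarith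
      then have "(norm (X i - X j))\<^sup>2 < e\<^sup>2" using m by simp
      then show ?thesis using e by (simp add: dist_norm power2_less_imp_less)
    qed
    then show "\<exists>N. \<forall>i\<ge>N. \<forall>j\<ge>N. dist (X i) (X j) < e" by blast
  qed
  then obtain x where x: "X \<longlonglongrightarrow> x" using Cauchy_convergent convergent_def by blast
  have "x \<in> D" "F x \<le> I"
    using closed_strongly_convexD(4,5)[OF A x c X] by auto
  then show ?thesis using I by force
qed

section \<open>Asymptotic centers and weak convergence\<close>

text \<open>The limit superior of \<open>(norm (u n - q))\<^sup>2\<close> along the filter is
  strongly convex in \<open>q\<close> with modulus 2. The center \<open>c\<close> is its minimizer,
  \<open>R\<close> its minimum, and the last inequality is quadratic growth, phrased through
  eventual upper bounds.\<close>

lemma asymptotic_center_exists: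
  fixes u :: "'i \<Rightarrow> 'a::{real_inner, complete_space}"
  assumes ntriv: "\<F> \<noteq> bot" and bound: "\<And>n. norm (u n) \<le> M"
  shows "\<exists>c R. (\<forall>r>R. \<forall>\<^sub>F n in \<F>. (norm (u n - c))\<^sup>2 \<le> r) \<and>
    (\<forall>q r. (\<forall>\<^sub>F n in \<F>. (norm (u n - q))\<^sup>2 \<le> r) \<longrightarrow> R + (norm (q - c))\<^sup>2 \<le> r)"
proof -
  \<comment> \<open>The infimum of the eventual upper bounds is the limit superior along the filter;
    it is finite because \<open>u\<close> is bounded and the filter is nontrivial.\<close>
  define S where "S q = {r. \<forall>\<^sub>F n in \<F>. (norm (u n - q))\<^sup>2 \<le> r}" for q
  define \<phi> where "\<phi> q = Inf (S q)" for q
  have pos: "0 \<le> r" if "r \<in> S q" for r q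
  proof -
    have "\<forall>\<^sub>F n in \<F>. 0 \<le> r"
      using that unfolding S_def mem_Collect_eq
      by eventually_elim (meson order_trans zero_le_power2)
    then show ?thesis using ntriv by (simp add: eventually_const)
  qed
  have bdd: "bdd_below (S q)" for q using pos by (auto intro!: bdd_belowI)
  have ne: "S q \<noteq> {}" for q
  proof -
    have "norm (u n - q) \<le> M + norm q" for n
      using norm_triangle_ineq4[of "u n" q] bound[of n] by linarith
    then have "(M + norm q)\<^sup>2 \<in> S q" unfolding S_def by (simp add: power_mono)
    then show ?thesis by blast
  qed
  have le: "\<phi> q \<le> r" if "r \<in> S q" for q r
    unfolding \<phi>_def using that bdd by (rule cInf_lower)
  have S: "r \<in> S q" if r: "\<phi> q < r" for q r
  proof -
    obtain s where s: "s \<in> S q" "s < r" using cInf_lessD[OF ne r[unfolded \<phi>_def]] by blast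
    show ?thesis using s(1) unfolding S_def mem_Collect_eq
      by eventually_elim (use s(2) in linarith)
  qed
  \<comment> \<open>Each function \<open>(norm (u n - q))\<^sup>2\<close> satisfies the convexity
    relation with equality, with a quadratic term independent of \<open>n\<close>, so the bound
    survives the limit superior.\<close>
  have "closed_strongly_convex 2 UNIV \<phi>"
  proof (rule closed_strongly_convexI)
    fix x y :: 'a and t :: real assume t: "0 \<le> t" "t \<le> 1"
    show "\<phi> ((1 - t) *\<^sub>R x + t *\<^sub>R y) \<le> (1 - t) * \<phi> x + t * \<phi> y - 2 / 2 * (t * (1 - t) * (norm (x - y))\<^sup>2)"
    proof (rule field_le_epsilon)
      fix e :: real assume e: "0 < e"
      have "\<forall>\<^sub>F n in \<F>. (norm (u n - x))\<^sup>2 \<le> \<phi> x + e" "\<forall>\<^sub>F n in \<F>. (norm (u n - y))\<^sup>2 \<le> \<phi> y + e"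
        using S[of x "\<phi> x + e"] S[of y "\<phi> y + e"] e by (auto simp: S_def)
      then have "\<forall>\<^sub>F n in \<F>. (norm (u n - ((1 - t) *\<^sub>R x + t *\<^sub>R y)))\<^sup>2
        \<le> (1 - t) * \<phi> x + t * \<phi> y - 2 / 2 * (t * (1 - t) * (norm (x - y))\<^sup>2) + e"
      proof eventually_elim
        case (elim n)
        have "u n - ((1 - t) *\<^sub>R x + t *\<^sub>R y) = (1 - t) *\<^sub>R (u n - x) + t *\<^sub>R (u n - y)"
          by (simp add: algebra_simps)
        then have "(norm (u n - ((1 - t) *\<^sub>R x + t *\<^sub>R y)))\<^sup>2
          = (1 - t) * (norm (u n - x))\<^sup>2 + t * (norm (u n - y))\<^sup>2 - t * (1 - t) * (norm (x - y))\<^sup>2"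
          by (simp only: norm_convex_combination) (simp add: norm_minus_commute)
        moreover have "(1 - t) * (norm (u n - x))\<^sup>2 \<le> (1 - t) * (\<phi> x + e)"
          using elim t by (intro mult_left_mono) auto
        moreover have "t * (norm (u n - y))\<^sup>2 \<le> t * (\<phi> y + e)"
          using elim t by (intro mult_left_mono) auto
        ultimately show ?case by (simp add: algebra_simps)
      qed
      then show "\<phi> ((1 - t) *\<^sub>R x + t *\<^sub>R y)
        \<le> (1 - t) * \<phi> x + t * \<phi> y - 2 / 2 * (t * (1 - t) * (norm (x - y))\<^sup>2) + e"
        by (intro le) (simp add: S_def)
    qed
  next
    fix X :: "nat \<Rightarrow> 'a" and x c C
    assume X: "X \<longlonglongrightarrow> x" and c: "c \<longlonglongrightarrow> (C::real)" and \<phi>X: "\<And>n. \<phi> (X n) \<le> c n"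
    \<comment> \<open>A Lipschitz estimate on bounded sets, uniform in \<open>n\<close>, supplies
      the lower semicontinuity of \<open>\<phi>\<close>.\<close>
    have lip: "\<phi> q \<le> \<phi> q' + norm (q' - q) * (2 * M + norm q + norm q')" for q q'
    proof (rule field_le_epsilon)
      fix e :: real assume e: "0 < e"
      have "\<forall>\<^sub>F n in \<F>. (norm (u n - q'))\<^sup>2 \<le> \<phi> q' + e"
        using S[of q' "\<phi> q' + e"] e by (auto simp: S_def)
      then have "\<forall>\<^sub>F n in \<F>. (norm (u n - q))\<^sup>2 \<le> \<phi> q' + norm (q' - q) * (2 * M + norm q + norm q') + e"
      proof eventually_elim
        case (elim n)
        have "(norm (u n - q))\<^sup>2 = (norm (u n - q'))\<^sup>2 + inner (q' - q) (2 *\<^sub>R u n - q - q')"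
          by (simp add: power2_norm_eq_inner inner_diff_left inner_diff_right inner_commute algebra_simps)
        moreover have "inner (q' - q) (2 *\<^sub>R u n - q - q') \<le> norm (q' - q) * norm (2 *\<^sub>R u n - q - q')"
          by (rule norm_cauchy_schwarz)
        moreover have "norm (2 *\<^sub>R u n - q - q') \<le> 2 * M + norm q + norm q'"
          using norm_triangle_ineq4[of "2 *\<^sub>R u n - q" q'] norm_triangle_ineq4[of "2 *\<^sub>R u n" q] bound[of n]
          by simp
        then have "norm (q' - q) * norm (2 *\<^sub>R u n - q - q') \<le> norm (q' - q) * (2 * M + norm q + norm q')"
          by (intro mult_left_mono) auto
        ultimately show ?case using elim by linarith
      qed
      then show "\<phi> q \<le> \<phi> q' + norm (q' - q) * (2 * M + norm q + norm q') + e"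
        by (intro le) (simp add: S_def)
    qed
    have "(\<lambda>n. c n + norm (X n - x) * (2 * M + norm x + norm (X n)))
        \<longlonglongrightarrow> C + norm (x - x) * (2 * M + norm x + norm x)"
      by (intro tendsto_intros X c)
    moreover have "\<phi> x \<le> c n + norm (X n - x) * (2 * M + norm x + norm (X n))" for n
      using lip[of x "X n"] \<phi>X[of n] by linarith
    ultimately have "\<phi> x \<le> C + norm (x - x) * (2 * M + norm x + norm x)"
      by (intro LIMSEQ_le_const) auto
    then show "x \<in> UNIV \<and> \<phi> x \<le> C" by simp
  qed auto
  note \<phi> = this
  obtain c where c: "\<And>w. \<phi> c \<le> \<phi> w" using strongly_convex_minimizer_exists[OF \<phi>] by auto
  have "\<phi> c + (norm (q - c))\<^sup>2 \<le> \<phi> q" for q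
    using strongly_convex_minimizer_growth[OF \<phi>, of c q] c by simp
  then have "\<phi> c + (norm (q - c))\<^sup>2 \<le> r" if "r \<in> S q" for q r
    using le[OF that] by (meson order_trans)
  with S[of c] show ?thesis unfolding S_def by blast
qed

text \<open>Opial's lemma and the demiclosedness principle in one, both carried out on asymptotic
  centers.\<close>

lemma opial_nonexpansive:
  fixes u :: "nat \<Rightarrow> 'a::{real_inner, complete_space}"
  assumes nonexp: "\<And>p q. norm (T p - T q) \<le> norm (p - q)"
    and asym: "(\<lambda>n. u n - T (u n)) \<longlonglongrightarrow> 0"
    and conv: "\<And>p. T p = p \<Longrightarrow> convergent (\<lambda>n. (norm (u n - p))\<^sup>2)"
    and bound: "\<And>n. norm (u n) \<le> M"
  shows "\<exists>p. T p = p \<and> weakly_converges_to u p"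
proof -
  \<comment> \<open>Since \<open>u n - T (u n)\<close> vanishes, \<open>T c\<close> is
    asymptotically no farther from \<open>u n\<close> than \<open>c\<close> is. Growth around the
    center then forces \<open>norm (T c - c)\<close> to be 0.\<close>
  have fixed: "T c = c"
    if \<F>: "\<F> \<le> sequentially" and c1: "\<And>r. r > R \<Longrightarrow> \<forall>\<^sub>F n in \<F>. (norm (u n - c))\<^sup>2 \<le> r"
    and c2: "\<And>q r. \<forall>\<^sub>F n in \<F>. (norm (u n - q))\<^sup>2 \<le> r \<Longrightarrow> R + (norm (q - c))\<^sup>2 \<le> r" for \<F> c R
  proof -
    define d where "d n = norm (u n - T (u n))" for n
    have d: "d \<longlonglongrightarrow> 0" unfolding d_def using asym by (rule tendsto_norm_zero)
    have lim: "(\<lambda>n. d n * (2 * (M + norm c) + d n)) \<longlonglongrightarrow> 0 * (2 * (M + norm c) + 0)"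
      by (intro tendsto_intros d)
    have est: "(norm (u n - T c))\<^sup>2 \<le> (norm (u n - c))\<^sup>2 + d n * (2 * (M + norm c) + d n)" for n
    proof -
      have "norm (u n - T c) \<le> norm (u n - T (u n)) + norm (T (u n) - T c)"
        using dist_triangle[of "u n" "T c" "T (u n)"] by (simp add: dist_norm)
      then have "norm (u n - T c) \<le> d n + norm (u n - c)"
        using nonexp[of "u n" c] unfolding d_def by linarith
      then have "(norm (u n - T c))\<^sup>2 \<le> (d n + norm (u n - c))\<^sup>2" by (rule power_mono) simp
      also have "\<dots> = (norm (u n - c))\<^sup>2 + d n * (2 * norm (u n - c) + d n)"
        by (simp add: power2_eq_square algebra_simps)
      also have "\<dots> \<le> (norm (u n - c))\<^sup>2 + d n * (2 * (M + norm c) + d n)"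
        using norm_triangle_ineq4[of "u n" c] bound[of n]
        by (intro add_left_mono mult_left_mono) (auto simp: d_def)
      finally show ?thesis .
    qed
    have "R + (norm (T c - c))\<^sup>2 \<le> R"
    proof (rule field_le_epsilon)
      fix e :: real assume e: "0 < e"
      have "\<forall>\<^sub>F n in sequentially. d n * (2 * (M + norm c) + d n) < e / 2"
        using order_tendstoD(2)[OF lim, of "e / 2"] e by simp
      then have "\<forall>\<^sub>F n in \<F>. d n * (2 * (M + norm c) + d n) < e / 2"
        using \<F> filter_leD by blast
      moreover have "\<forall>\<^sub>F n in \<F>. (norm (u n - c))\<^sup>2 \<le> R + e / 2" using c1 e by simp
      ultimately have "\<forall>\<^sub>F n in \<F>. (norm (u n - T c))\<^sup>2 \<le> R + e"
        by eventually_elim (use est in \<open>smt (verit) field_sum_of_halves\<close>)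
      then show "R + (norm (T c - c))\<^sup>2 \<le> R + e" by (rule c2)
    qed
    then show ?thesis by simp
  qed
  \<comment> \<open>Where the full limits exist, they can be compared through any finer nontrivial
    filter: \<open>l\<close> is at most the minimum \<open>R\<close>, and \<open>l'\<close> obeys
    the growth inequality.\<close>
  have gap: "l + (norm (q - c))\<^sup>2 \<le> l'"
    if \<F>: "\<F> \<le> sequentially" "\<F> \<noteq> bot" and c1: "\<And>r. r > R \<Longrightarrow> \<forall>\<^sub>F n in \<F>. (norm (u n - c))\<^sup>2 \<le> r"
    and c2: "\<And>q r. \<forall>\<^sub>F n in \<F>. (norm (u n - q))\<^sup>2 \<le> r \<Longrightarrow> R + (norm (q - c))\<^sup>2 \<le> r"
    and l: "(\<lambda>n. (norm (u n - c))\<^sup>2) \<longlonglongrightarrow> l" and l': "(\<lambda>n. (norm (u n - q))\<^sup>2) \<longlonglongrightarrow> l'" for \<F> c R q l l'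
  proof -
    have "l \<le> R"
    proof (rule dense_ge)
      fix r assume "R < r"
      then show "l \<le> r" using tendsto_upperbound[OF tendsto_mono[OF \<F>(1) l] c1 \<F>(2)] by blast
    qed
    moreover have "R + (norm (q - c))\<^sup>2 \<le> l'"
    proof (rule dense_ge)
      fix r assume "l' < r"
      then have "\<forall>\<^sub>F n in \<F>. (norm (u n - q))\<^sup>2 < r"
        using order_tendstoD(2)[OF tendsto_mono[OF \<F>(1) l']] by blast
      then have "\<forall>\<^sub>F n in \<F>. (norm (u n - q))\<^sup>2 \<le> r" by eventually_elim simp
      then show "R + (norm (q - c))\<^sup>2 \<le> r" by (rule c2)
    qed
    ultimately show ?thesis by linarith
  qed
  obtain c R where c1: "\<And>r. r > R \<Longrightarrow> \<forall>\<^sub>F n in sequentially. (norm (u n - c))\<^sup>2 \<le> r"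
    and c2: "\<And>q r. \<forall>\<^sub>F n in sequentially. (norm (u n - q))\<^sup>2 \<le> r \<Longrightarrow> R + (norm (q - c))\<^sup>2 \<le> r"
    using asymptotic_center_exists[OF sequentially_bot, of u M] bound by blast
  have Tc: "T c = c" by (rule fixed[OF order_refl c1 c2])
  obtain l where l: "(\<lambda>n. (norm (u n - c))\<^sup>2) \<longlonglongrightarrow> l" using conv[OF Tc] convergent_def by blast
  txt \<open>If \<open>inner (u n - c) w\<close> were at least \<open>e\<close> frequently, then along that filter \<open>c + w\<close> would violate the
    minimality of the center \<open>c\<close>.\<close>
  have less: "\<forall>\<^sub>F n in sequentially. inner (u n - c) w < e" if e: "e > 0" for w e
  proof (rule ccontr)
    assume neg: "\<not> ?thesis"
    define \<F> where "\<F> = inf sequentially (principal {n. e \<le> inner (u n - c) w})"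
    have le: "\<F> \<le> sequentially" unfolding \<F>_def by simp
    have nt: "\<F> \<noteq> bot"
      using neg by (auto simp: \<F>_def trivial_limit_def eventually_inf_principal not_le)
    obtain c' R' where c1': "\<And>r. r > R' \<Longrightarrow> \<forall>\<^sub>F n in \<F>. (norm (u n - c'))\<^sup>2 \<le> r"
      and c2': "\<And>q r. \<forall>\<^sub>F n in \<F>. (norm (u n - q))\<^sup>2 \<le> r \<Longrightarrow> R' + (norm (q - c'))\<^sup>2 \<le> r"
      using asymptotic_center_exists[OF nt, of u M] bound by blast
    have Tc': "T c' = c'" by (rule fixed[OF le c1' c2'])
    obtain l' where l': "(\<lambda>n. (norm (u n - c'))\<^sup>2) \<longlonglongrightarrow> l'" using conv[OF Tc'] convergent_def by blast
    \<comment> \<open>\<open>gap\<close> is applied twice with the roles of the two centers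
      exchanged; adding the results cancels \<open>l\<close> and \<open>l'\<close>.\<close>
    have "l + (norm (c' - c))\<^sup>2 \<le> l'" by (rule gap[OF order_refl sequentially_bot c1 c2 l l'])
    moreover have "l' + (norm (c - c'))\<^sup>2 \<le> l" by (rule gap[OF le nt c1' c2' l' l])
    ultimately have "(norm (c' - c))\<^sup>2 \<le> 0" using zero_le_power2[of "norm (c - c')"] by linarith
    then have cc: "c' = c" by simp
    have "\<forall>\<^sub>F n in \<F>. (norm (u n - c))\<^sup>2 \<le> R' + e" using c1' e cc by simp
    moreover have "\<forall>\<^sub>F n in \<F>. e \<le> inner (u n - c) w" unfolding \<F>_def by (simp add: eventually_inf_principal)
    \<comment> \<open>The cross term contributes at most \<open>- 2 * e\<close> against the slack
      \<open>e\<close>, so \<open>c + w\<close> beats the growth bound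
      \<open>R' + (norm w)\<^sup>2\<close> by \<open>e\<close>.\<close>
    ultimately have "\<forall>\<^sub>F n in \<F>. (norm (u n - (c + w)))\<^sup>2 \<le> R' - e + (norm w)\<^sup>2"
    proof eventually_elim
      case (elim n)
      have "(norm (u n - (c + w)))\<^sup>2 = (norm (u n - c))\<^sup>2 - 2 * inner (u n - c) w + (norm w)\<^sup>2"
        by (simp add: power2_norm_eq_inner inner_diff_left inner_diff_right inner_add_left inner_add_right
            inner_commute)
      then show ?case using elim by linarith
    qed
    from c2'[OF this] show False using e cc by simp
  qed
  have "weakly_converges_to u c"
    unfolding weakly_converges_to_def
  proof
    fix w
    have "(\<lambda>n. inner (u n - c) w) \<longlonglongrightarrow> 0"
    proof (rule order_tendstoI)
      \<comment> \<open>The lower bound is the upper bound \<open>less\<close> for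
        \<open>- w\<close>.\<close>
      fix e :: real assume "e < 0"
      then have "\<forall>\<^sub>F n in sequentially. inner (u n - c) (- w) < - e" by (intro less) simp
      then show "\<forall>\<^sub>F n in sequentially. e < inner (u n - c) w" by simp
    qed (rule less)
    then have "(\<lambda>n. inner (u n) w - inner c w) \<longlonglongrightarrow> 0" by (simp add: inner_diff_left)
    then show "(\<lambda>n. inner (u n) w) \<longlonglongrightarrow> inner c w" by (simp add: LIM_zero_iff)
  qed
  with Tc show ?thesis by blast
qed

section \<open>The inertial Krasnoselskii-Mann iteration\<close>

lemma power2_norm_add:
  fixes x y :: "'a::real_inner"
  shows "(norm (x + y))\<^sup>2 = (norm x)\<^sup>2 + 2 * inner x y + (norm y)\<^sup>2"
  by (simp add: power2_norm_eq_inner inner_add_left inner_add_right inner_commute)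

lemma tendsto_inner_null_bounded:
  fixes s w :: "nat \<Rightarrow> 'a::real_inner"
  assumes s: "s \<longlonglongrightarrow> 0" and w: "\<And>n. norm (w n) \<le> M"
  shows "(\<lambda>n. inner (s n) (w n)) \<longlonglongrightarrow> 0"
proof (rule Lim_null_comparison)
  show "\<forall>\<^sub>F n in sequentially. norm (inner (s n) (w n)) \<le> norm (s n) * M"
  proof (intro always_eventually allI)
    fix n
    have "\<bar>inner (s n) (w n)\<bar> \<le> norm (s n) * norm (w n)" by (rule Cauchy_Schwarz_ineq2)
    also have "\<dots> \<le> norm (s n) * M" using w by (intro mult_left_mono) auto
    finally show "norm (inner (s n) (w n)) \<le> norm (s n) * M" by simp
  qed
  show "(\<lambda>n. norm (s n) * M) \<longlonglongrightarrow> 0"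
    using s by (intro tendsto_mult_left_zero tendsto_norm_zero)
qed

text \<open>Firm nonexpansiveness is what permits relaxation factors up to 2. Since the Lyapunov
  values converge, their increments vanish, and each increment dominates both the fixed point
  residual and the inertial displacement.\<close>

lemma inertial_krasnoselskii_mann:
  fixes T :: "'a::{real_inner, complete_space} \<Rightarrow> 'a" and x v u :: "nat \<Rightarrow> 'a"
  assumes firm: "\<And>p q. (norm (T p - T q))\<^sup>2 + (norm ((T p - p) - (T q - q)))\<^sup>2 \<le> (norm (p - q))\<^sup>2"
    and fix_ne: "T p0 = p0"
    and \<theta>: "\<theta> \<ge> 0" and a: "0 < a" and \<kappa>: "\<And>n. a \<le> \<kappa> n" "\<And>n. \<kappa> n \<le> b" and b: "b < 2"
    and u: "\<And>n. u n = (1 / (1 + \<theta>)) *\<^sub>R x n + (\<theta> / (1 + \<theta>)) *\<^sub>R v n"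
    and x: "\<And>n. x (Suc n) = u n + \<kappa> n *\<^sub>R (T (u n) - u n)"
    and v: "\<And>n. v (Suc n) = (1 / (1 + \<theta>)) *\<^sub>R x (Suc n) + (\<theta> / (1 + \<theta>)) *\<^sub>R v n"
  shows "\<exists>p. T p = p \<and> weakly_converges_to x p"
proof -
  define t where "t = \<theta> / (1 + \<theta>)"
  have t1: "1 / (1 + \<theta>) = 1 - t" and t: "0 \<le> t" "t < 1"
    using \<theta> unfolding t_def by (simp_all add: field_simps)
  have u: "u n = (1 - t) *\<^sub>R x n + t *\<^sub>R v n" for n using u[of n] by (simp only: t1 t_def[symmetric])
  have v: "v (Suc n) = (1 - t) *\<^sub>R x (Suc n) + t *\<^sub>R v n" for n using v[of n] by (simp only: t1 t_def[symmetric])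
  txt \<open>The weights of this Lyapunov function are the ones for which the \<open>x\<close>- and \<open>v\<close>-terms balance exactly in
    \<open>descent\<close> below.\<close>
  define E where "E p n = (1 - t)\<^sup>2 * (norm (x n - p))\<^sup>2 + t * (norm (v n - p))\<^sup>2" for p n
  \<comment> \<open>A uniform lower bound for \<open>\<kappa> n * (2 - \<kappa> n)\<close>, from
    \<open>\<kappa> n \<ge> a\<close> and \<open>2 - \<kappa> n \<ge> 2 - b\<close>.\<close>
  define d where "d = a * (2 - b)"
  have d: "d > 0" using a b unfolding d_def by simp
  have shift: "(norm ((1 - t) *\<^sub>R y + t *\<^sub>R w - p))\<^sup>2
    = (1 - t) * (norm (y - p))\<^sup>2 + t * (norm (w - p))\<^sup>2 - t * (1 - t) * (norm (y - w))\<^sup>2" for y w p :: 'a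
  proof -
    have "(1 - t) *\<^sub>R y + t *\<^sub>R w - p = (1 - t) *\<^sub>R (y - p) + t *\<^sub>R (w - p)" by (simp add: algebra_simps)
    then show ?thesis by (simp only: norm_convex_combination) simp
  qed
  have relax: "(norm (x (Suc n) - p))\<^sup>2 \<le> (norm (u n - p))\<^sup>2 - d * (norm (T (u n) - u n))\<^sup>2"
    if p: "T p = p" for p n
  proof -
    define W where "W = T (u n) - u n"
    define k where "k = \<kappa> n"
    have "T (u n) - T p = (u n - p) + W" using p by (simp add: W_def)
    then have "(norm ((u n - p) + W))\<^sup>2 + (norm W)\<^sup>2 \<le> (norm (u n - p))\<^sup>2"
      using firm[of "u n" p] p by (simp add: W_def)
    then have i: "inner (u n - p) W + (norm W)\<^sup>2 \<le> 0"
      by (simp add: power2_norm_add)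
    have k: "a \<le> k" "k \<le> b" using \<kappa> unfolding k_def by auto
    have "x (Suc n) - p = (u n - p) + k *\<^sub>R W" using x by (simp add: W_def k_def)
    then have "(norm (x (Suc n) - p))\<^sup>2 = (norm (u n - p))\<^sup>2 + 2 * k * inner (u n - p) W + k\<^sup>2 * (norm W)\<^sup>2"
      by (simp only: power2_norm_add) (simp add: power_mult_distrib)
    \<comment> \<open>Regrouped so that \<open>i\<close>, which is firm nonexpansiveness at a fixed
      point, gives the middle term its sign.\<close>
    also have "\<dots> = (norm (u n - p))\<^sup>2 + 2 * k * (inner (u n - p) W + (norm W)\<^sup>2) - k * (2 - k) * (norm W)\<^sup>2"
      by (simp add: algebra_simps power2_eq_square)
    also have "\<dots> \<le> (norm (u n - p))\<^sup>2 - d * (norm W)\<^sup>2"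
    proof -
      have "k * (inner (u n - p) W + (norm W)\<^sup>2) \<le> 0" using i a k by (intro mult_nonneg_nonpos) auto
      moreover have "d * (norm W)\<^sup>2 \<le> k * (2 - k) * (norm W)\<^sup>2"
        unfolding d_def using a b k by (intro mult_right_mono mult_mono) auto
      ultimately show ?thesis by linarith
    qed
    finally show ?thesis by (simp add: W_def)
  qed
  have descent: "(1 - t)\<^sup>2 * (t * (norm (v n - x n))\<^sup>2) + (1 - t) * d * (norm (T (u n) - u n))\<^sup>2
      \<le> E p n - E p (Suc n)" if p: "T p = p" for p n
  proof -
    \<comment> \<open>Expanding \<open>v (Suc n)\<close> gives the new iterate the total weight
      \<open>(1 - t)\<^sup>2 + t * (1 - t) = 1 - t\<close>, matching the weight under which
      \<open>relax\<close> can be inserted.\<close>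
    have "E p (Suc n) = (1 - t) * (norm (x (Suc n) - p))\<^sup>2 + t\<^sup>2 * (norm (v n - p))\<^sup>2
        - t * (t * (1 - t) * (norm (x (Suc n) - v n))\<^sup>2)"
      unfolding E_def v[of n] shift by (simp add: algebra_simps power2_eq_square)
    also have "\<dots> \<le> (1 - t) * (norm (x (Suc n) - p))\<^sup>2 + t\<^sup>2 * (norm (v n - p))\<^sup>2" using t by simp
    also have "\<dots> \<le> (1 - t) * ((norm (u n - p))\<^sup>2 - d * (norm (T (u n) - u n))\<^sup>2) + t\<^sup>2 * (norm (v n - p))\<^sup>2"
      using relax[OF p, of n] t by (intro add_right_mono mult_left_mono) auto
    also have "\<dots> = E p n - (1 - t)\<^sup>2 * (t * (norm (v n - x n))\<^sup>2) - (1 - t) * d * (norm (T (u n) - u n))\<^sup>2"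
      unfolding E_def u[of n] shift norm_minus_commute[of "v n" "x n"] by (simp add: algebra_simps power2_eq_square)
    finally show ?thesis by linarith
  qed
  have Epos: "0 \<le> E p n" for p n unfolding E_def using t by simp
  have dec: "decseq (E p)" if p: "T p = p" for p
  proof (rule decseq_SucI)
    fix n
    have "0 \<le> (1 - t)\<^sup>2 * (t * (norm (v n - x n))\<^sup>2) + (1 - t) * d * (norm (T (u n) - u n))\<^sup>2"
      using t d by simp
    then show "E p (Suc n) \<le> E p n" using descent[OF p, of n] by linarith
  qed
  have Elim: "\<exists>l. E p \<longlonglongrightarrow> l" if p: "T p = p" for p
    using decseq_convergent[OF dec[OF p]] Epos by metis
  obtain l where l: "E p0 \<longlonglongrightarrow> l" using Elim[OF fix_ne] by blast
  have diff: "(\<lambda>n. E p0 n - E p0 (Suc n)) \<longlonglongrightarrow> 0"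
    using tendsto_diff[OF l LIMSEQ_Suc[OF l]] by simp
  \<comment> \<open>For \<open>t = 0\<close>, \<open>descent\<close> carries no information on
    \<open>v n - x n\<close>, so the factor \<open>t\<close> stays; it is exactly what
    \<open>u n - x n\<close> requires.\<close>
  have vx: "(\<lambda>n. t * (norm (v n - x n))\<^sup>2) \<longlonglongrightarrow> 0"
  proof (rule Lim_null_comparison)
    show "(\<lambda>n. (E p0 n - E p0 (Suc n)) / (1 - t)\<^sup>2) \<longlonglongrightarrow> 0" using tendsto_divide_zero[OF diff] .
    have "norm (t * (norm (v n - x n))\<^sup>2) \<le> (E p0 n - E p0 (Suc n)) / (1 - t)\<^sup>2" for n
    proof -
      have "0 \<le> (1 - t) * d * (norm (T (u n) - u n))\<^sup>2" using t d by simp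
      then have "(1 - t)\<^sup>2 * (t * (norm (v n - x n))\<^sup>2) \<le> E p0 n - E p0 (Suc n)"
        using descent[OF fix_ne, of n] by linarith
      then show ?thesis using t by (simp add: pos_le_divide_eq mult.commute)
    qed
    then show "\<forall>\<^sub>F n in sequentially. norm (t * (norm (v n - x n))\<^sup>2) \<le> (E p0 n - E p0 (Suc n)) / (1 - t)\<^sup>2"
      by simp
  qed
  have W2: "(\<lambda>n. (norm (T (u n) - u n))\<^sup>2) \<longlonglongrightarrow> 0"
  proof (rule Lim_null_comparison)
    show "(\<lambda>n. (E p0 n - E p0 (Suc n)) / ((1 - t) * d)) \<longlonglongrightarrow> 0" using tendsto_divide_zero[OF diff] .
    have "norm ((norm (T (u n) - u n))\<^sup>2) \<le> (E p0 n - E p0 (Suc n)) / ((1 - t) * d)" for n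
    proof -
      have "0 \<le> (1 - t)\<^sup>2 * (t * (norm (v n - x n))\<^sup>2)" using t by simp
      then have "(1 - t) * d * (norm (T (u n) - u n))\<^sup>2 \<le> E p0 n - E p0 (Suc n)"
        using descent[OF fix_ne, of n] by linarith
      then show ?thesis using t d by (simp add: pos_le_divide_eq mult.commute)
    qed
    then show "\<forall>\<^sub>F n in sequentially. norm ((norm (T (u n) - u n))\<^sup>2) \<le> (E p0 n - E p0 (Suc n)) / ((1 - t) * d)"
      by simp
  qed
  have "(\<lambda>n. norm (T (u n) - u n)) \<longlonglongrightarrow> 0" using tendsto_real_sqrt[OF W2] by simp
  then have "(\<lambda>n. norm (u n - T (u n))) \<longlonglongrightarrow> 0" by (simp add: norm_minus_commute)
  then have asym: "(\<lambda>n. u n - T (u n)) \<longlonglongrightarrow> 0" by (rule tendsto_norm_zero_cancel)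
  have ux: "u n - x n = t *\<^sub>R (v n - x n)" for n unfolding u by (simp add: algebra_simps)
  have "(\<lambda>n. t * (t * (norm (v n - x n))\<^sup>2)) \<longlonglongrightarrow> 0" by (rule tendsto_mult_right_zero[OF vx])
  moreover have "t * (t * (norm (v n - x n))\<^sup>2) = (norm (u n - x n))\<^sup>2" for n
    using t by (simp add: ux power_mult_distrib power2_eq_square)
  ultimately have "(\<lambda>n. (norm (u n - x n))\<^sup>2) \<longlonglongrightarrow> 0" by simp
  from tendsto_real_sqrt[OF this] have "(\<lambda>n. norm (u n - x n)) \<longlonglongrightarrow> 0" by simp
  then have ux0: "(\<lambda>n. u n - x n) \<longlonglongrightarrow> 0" by (rule tendsto_norm_zero_cancel)
  have xbound: "\<exists>M. \<forall>n. norm (x n - p) \<le> M" if p: "T p = p" for p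
  proof -
    have "norm (x n - p) \<le> sqrt (E p 0 / (1 - t)\<^sup>2)" for n
    proof (rule real_le_rsqrt)
      have "E p n \<le> E p 0" using decseqD[OF dec[OF p], of 0 n] by simp
      moreover have "0 \<le> t * (norm (v n - p))\<^sup>2" using t by simp
      ultimately have "(1 - t)\<^sup>2 * (norm (x n - p))\<^sup>2 \<le> E p 0" unfolding E_def by linarith
      then show "(norm (x n - p))\<^sup>2 \<le> E p 0 / (1 - t)\<^sup>2"
        using t by (simp add: pos_le_divide_eq mult.commute)
    qed
    then show ?thesis by blast
  qed
  have conv: "convergent (\<lambda>n. (norm (u n - p))\<^sup>2)" if p: "T p = p" for p
  proof -
    obtain M where M: "\<And>n. norm (x n - p) \<le> M" using xbound[OF p] by blast
    have cross: "(\<lambda>n. inner (u n - x n) (x n - p)) \<longlonglongrightarrow> 0" by (rule tendsto_inner_null_bounded[OF ux0 M])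
    obtain l where l: "E p \<longlonglongrightarrow> l" using Elim[OF p] by blast
    \<comment> \<open>Expanding \<open>v n - p\<close> around \<open>x n - p\<close> gives
      \<open>E p n\<close> the coefficient \<open>q\<close> on
      \<open>(norm (x n - p))\<^sup>2\<close>. The cross term is
      \<open>2 * inner (u n - x n) (x n - p)\<close> because
      \<open>t *\<^sub>R (v n - x n) = u n - x n\<close>, so it vanishes in the limit.\<close>
    define q where "q = (1 - t)\<^sup>2 + t"
    have q: "q > 0" using t unfolding q_def by (simp add: add_pos_nonneg)
    have "(\<lambda>n. (E p n - 2 * inner (u n - x n) (x n - p) - t * (norm (v n - x n))\<^sup>2) / q)
        \<longlonglongrightarrow> (l - 2 * 0 - 0) / q"
      using q by (intro tendsto_intros l cross vx) simp
    moreover have "(E p n - 2 * inner (u n - x n) (x n - p) - t * (norm (v n - x n))\<^sup>2) / q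
        = (norm (x n - p))\<^sup>2" for n
    proof -
      have "v n - p = (v n - x n) + (x n - p)" by simp
      then have "(norm (v n - p))\<^sup>2 = (norm (v n - x n))\<^sup>2 + 2 * inner (v n - x n) (x n - p) + (norm (x n - p))\<^sup>2"
        by (simp only: power2_norm_add)
      then have "E p n - 2 * inner (u n - x n) (x n - p) - t * (norm (v n - x n))\<^sup>2 = q * (norm (x n - p))\<^sup>2"
        unfolding E_def ux q_def inner_scaleR_left by (simp only:) (simp add: algebra_simps)
      then show ?thesis using q by simp
    qed
    ultimately have X: "(\<lambda>n. (norm (x n - p))\<^sup>2) \<longlonglongrightarrow> (l - 2 * 0 - 0) / q" by simp
    have "(\<lambda>n. (norm (u n - x n))\<^sup>2 + 2 * inner (u n - x n) (x n - p) + (norm (x n - p))\<^sup>2)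
        \<longlonglongrightarrow> (norm (0::'a))\<^sup>2 + 2 * 0 + (l - 2 * 0 - 0) / q"
      by (intro tendsto_intros ux0 cross X)
    moreover have "(norm (u n - x n))\<^sup>2 + 2 * inner (u n - x n) (x n - p) + (norm (x n - p))\<^sup>2
        = (norm (u n - p))\<^sup>2" for n
    proof -
      have "u n - p = (u n - x n) + (x n - p)" by simp
      then show ?thesis by (simp only: power2_norm_add)
    qed
    ultimately show ?thesis unfolding convergent_def by auto
  qed
  have nonexp: "norm (T p - T q) \<le> norm (p - q)" for p q
  proof (rule power2_le_imp_le)
    show "(norm (T p - T q))\<^sup>2 \<le> (norm (p - q))\<^sup>2"
      using firm[of p q] zero_le_power2[of "norm ((T p - p) - (T q - q))"] by linarith
  qed simp
  obtain M where M: "\<And>n. norm (u n - x n) \<le> M"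
    using convergent_imp_Bseq[OF convergentI[OF ux0]] unfolding Bseq_def by blast
  obtain M' where M': "\<And>n. norm (x n - p0) \<le> M'" using xbound[OF fix_ne] by blast
  have "norm (u n) \<le> M + M' + norm p0" for n
    using norm_triangle_ineq[of "u n - x n" "x n - p0"] norm_triangle_ineq[of "u n - p0" p0] M[of n] M'[of n]
    by simp
  from opial_nonexpansive[OF nonexp asym conv this]
  obtain p where p: "T p = p" "weakly_converges_to u p" by blast
  have "weakly_converges_to x p"
    unfolding weakly_converges_to_def
  proof
    fix w
    have "(\<lambda>n. inner (u n) w) \<longlonglongrightarrow> inner p w" using p(2) by (simp add: weakly_converges_to_def)
    then have "(\<lambda>n. inner (u n) w - inner (u n - x n) w) \<longlonglongrightarrow> inner p w - inner 0 w"
      by (rule tendsto_diff) (intro tendsto_inner ux0 tendsto_const)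
    then show "(\<lambda>n. inner (x n) w) \<longlonglongrightarrow> inner p w" by (simp add: inner_diff_left)
  qed
  with p(1) show ?thesis by blast
qed

section \<open>Subdifferentials and proximal maps of extended-valued functions\<close>

text \<open>Moves subgradients to real arithmetic on the effective domain. A point of finite value,
  supplied by properness, excludes \<open>f x = \<infinity>\<close>.\<close>

lemma subdifferential_iff:
  assumes "proper_fun f"
  shows "u \<in> subdifferential f x \<longleftrightarrow> f x \<noteq> \<infinity> \<and>
    (\<forall>z. f z \<noteq> \<infinity> \<longrightarrow> real_of_ereal (f x) + inner (z - x) u \<le> real_of_ereal (f z))"
proof -
  have fin: "f w = ereal (real_of_ereal (f w))" if "f w \<noteq> \<infinity>" for w
    using that assms by (cases "f w") (auto simp: proper_fun_def)
  obtain w0 where w0: "f w0 \<noteq> \<infinity>" using assms unfolding proper_fun_def by blast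
  show ?thesis
  proof (intro iffI conjI allI impI)
    assume u: "u \<in> subdifferential f x"
    show "f x \<noteq> \<infinity>"
    proof
      assume "f x = \<infinity>"
      moreover have "f x + ereal (inner (w0 - x) u) \<le> f w0" using u by (simp add: subdifferential_def)
      ultimately show False using w0 by simp
    qed
    fix z assume "f z \<noteq> \<infinity>"
    moreover have "f x + ereal (inner (z - x) u) \<le> f z" using u by (simp add: subdifferential_def)
    ultimately show "real_of_ereal (f x) + inner (z - x) u \<le> real_of_ereal (f z)"
      using fin[OF \<open>f x \<noteq> \<infinity>\<close>] fin[of z] by (metis ereal_less_eq(3) plus_ereal.simps(1))
  next
    assume A: "f x \<noteq> \<infinity> \<and>
      (\<forall>z. f z \<noteq> \<infinity> \<longrightarrow> real_of_ereal (f x) + inner (z - x) u \<le> real_of_ereal (f z))"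
    have "f x + ereal (inner (z - x) u) \<le> f z" for z
    proof (cases "f z = \<infinity>")
      case False
      then have "real_of_ereal (f x) + inner (z - x) u \<le> real_of_ereal (f z)" using A by blast
      then show ?thesis using fin[OF False] fin[of x] A by (metis ereal_less_eq(3) plus_ereal.simps(1))
    qed simp
    then show "u \<in> subdifferential f x" by (simp add: subdifferential_def)
  qed
qed

lemma lower_semicontinuous_sequence_le:
  fixes f :: "'a::topological_space \<Rightarrow> ereal"
  assumes f: "lower_semicontinuous f" and X: "X \<longlonglongrightarrow> x" and c: "c \<longlonglongrightarrow> C"
    and le: "\<And>n. f (X n) \<le> ereal (c n)"
  shows "f x \<le> ereal C"
proof (rule ccontr)
  assume "\<not> ?thesis"
  then have "ereal C < f x" by simp
  then obtain r where r: "ereal C < ereal r" "ereal r < f x" using ereal_dense2 by blast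
  have "f x \<le> Liminf (at x) f" using f by (simp add: lower_semicontinuous_def)
  then have "\<forall>\<^sub>F z in at x. ereal r < f z" using r(2) by (auto simp: le_Liminf_iff)
  \<comment> \<open>\<open>Liminf (at x)\<close> ignores \<open>x\<close> itself, but the sequence
    may visit \<open>x\<close>; the bound \<open>r(2)\<close> covers that case.\<close>
  then have "\<forall>\<^sub>F z in nhds x. ereal r < f z"
    using r(2) by (simp add: eventually_nhds_conv_at)
  then have "\<forall>\<^sub>F n in sequentially. ereal r < f (X n)"
    using X by (rule eventually_compose_filterlim)
  moreover have "\<forall>\<^sub>F n in sequentially. c n < r" using order_tendstoD(2)[OF c] r(1) by simp
  ultimately have "\<forall>\<^sub>F n in sequentially. False"
  proof eventually_elim
    case (elim n)
    have "ereal r < ereal (c n)" using elim(1) le[of n] by (rule less_le_trans)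
    then show ?case using elim(2) by simp
  qed
  then show False by simp
qed

text \<open>The bridge from the \<open>ereal\<close> hypotheses to the real-valued calculus: moving
  the subtracted quadratic back across convexity leaves precisely the defect given by
  \<open>norm_convex_combination\<close>.\<close>

lemma closed_strongly_convex_real_of_ereal:
  fixes f :: "'a::real_inner \<Rightarrow> ereal"
  assumes proper: "proper_fun f" and lsc: "lower_semicontinuous f" and sc: "strongly_convex_ereal \<rho> f"
  shows "closed_strongly_convex \<rho> {x. f x \<noteq> \<infinity>} (\<lambda>x. real_of_ereal (f x))"
proof -
  have fin: "f w = ereal (real_of_ereal (f w))" if "f w \<noteq> \<infinity>" for w
    using that proper by (cases "f w") (auto simp: proper_fun_def)
  have conv: "f ((1 - t) *\<^sub>R x + t *\<^sub>R y) \<noteq> \<infinity> \<and> real_of_ereal (f ((1 - t) *\<^sub>R x + t *\<^sub>R y))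
      \<le> (1 - t) * real_of_ereal (f x) + t * real_of_ereal (f y) - \<rho> / 2 * (t * (1 - t) * (norm (x - y))\<^sup>2)"
    if xy: "f x \<noteq> \<infinity>" "f y \<noteq> \<infinity>" and t: "0 \<le> t" "t \<le> 1" for x y t
  proof -
    let ?w = "(1 - t) *\<^sub>R x + t *\<^sub>R y"
    have "f ?w - ereal (\<rho> / 2 * (norm ?w)\<^sup>2) \<le> ereal (1 - t) * (f x - ereal (\<rho> / 2 * (norm x)\<^sup>2))
        + ereal t * (f y - ereal (\<rho> / 2 * (norm y)\<^sup>2))"
      using sc t unfolding strongly_convex_ereal_def convex_ereal_def by simp
    also have "\<dots> = ereal ((1 - t) * (real_of_ereal (f x) - \<rho> / 2 * (norm x)\<^sup>2)
        + t * (real_of_ereal (f y) - \<rho> / 2 * (norm y)\<^sup>2))"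
      by (subst fin[OF xy(1)], subst fin[OF xy(2)]) simp
    finally have le: "f ?w - ereal (\<rho> / 2 * (norm ?w)\<^sup>2)
      \<le> ereal ((1 - t) * (real_of_ereal (f x) - \<rho> / 2 * (norm x)\<^sup>2)
        + t * (real_of_ereal (f y) - \<rho> / 2 * (norm y)\<^sup>2))" .
    then have w: "f ?w \<noteq> \<infinity>" by auto
    have "real_of_ereal (f ?w) - \<rho> / 2 * (norm ?w)\<^sup>2 \<le> (1 - t) * (real_of_ereal (f x) - \<rho> / 2 * (norm x)\<^sup>2)
        + t * (real_of_ereal (f y) - \<rho> / 2 * (norm y)\<^sup>2)"
      using le by (subst (asm) fin[OF w]) simp
    then show ?thesis using w unfolding norm_convex_combination by (simp add: field_simps)
  qed
  show ?thesis
  proof (rule closed_strongly_convexI)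
    show "{x. f x \<noteq> \<infinity>} \<noteq> {}" using proper by (auto simp: proper_fun_def)
    fix X :: "nat \<Rightarrow> 'a" and x c C
    assume X: "X \<longlonglongrightarrow> x" and c: "c \<longlonglongrightarrow> C" and D: "\<And>n. X n \<in> {x. f x \<noteq> \<infinity>}"
      and le: "\<And>n. real_of_ereal (f (X n)) \<le> c n"
    have "f (X n) \<le> ereal (c n)" for n
      using D[of n] le[of n] fin[of "X n"] by (metis ereal_less_eq(3) mem_Collect_eq)
    from lower_semicontinuous_sequence_le[OF lsc X c this] have fx: "f x \<le> ereal C" .
    then have "f x \<noteq> \<infinity>" by auto
    then show "x \<in> {x. f x \<noteq> \<infinity>} \<and> real_of_ereal (f x) \<le> C"
      using fx fin[of x] by (metis ereal_less_eq(3) mem_Collect_eq)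
  qed (use conv in auto)
qed

text \<open>A subgradient \<open>a\<close> at \<open>x\<close> makes \<open>x\<close> a minimizer of
  \<open>f\<close> tilted by \<open>- a\<close>, so quadratic growth sharpens the subgradient
  inequality. Adding the sharpened inequalities at \<open>x\<close> and \<open>y\<close> cancels the
  function values.\<close>

lemma subdifferential_strongly_monotone:
  fixes f :: "'a::real_inner \<Rightarrow> ereal"
  assumes f: "proper_fun f" "lower_semicontinuous f" "strongly_convex_ereal \<rho> f"
    and a: "a \<in> subdifferential f x" and b: "b \<in> subdifferential f y"
  shows "\<rho> * (norm (x - y))\<^sup>2 \<le> inner (x - y) (a - b)"
proof -
  have growth: "real_of_ereal (f x) + inner (y - x) a + \<rho> / 2 * (norm (y - x))\<^sup>2 \<le> real_of_ereal (f y)"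
    if a: "a \<in> subdifferential f x" and y: "f y \<noteq> \<infinity>" for x y a
  proof -
    let ?G = "\<lambda>z. real_of_ereal (f z) + 0 * (norm (z - 0))\<^sup>2 + inner z (- a)"
    have sc: "closed_strongly_convex (\<rho> + 2 * 0) {x. f x \<noteq> \<infinity>} ?G"
      by (rule closed_strongly_convex_add_quadratic[OF closed_strongly_convex_real_of_ereal[OF f]])
    note s = a[unfolded subdifferential_iff[OF f(1)]]
    have "?G x \<le> ?G w" if "w \<in> {x. f x \<noteq> \<infinity>}" for w
      using s that by (auto simp: inner_diff_left algebra_simps)
    from strongly_convex_minimizer_growth[OF sc _ _ this, of y] show ?thesis
      using s y by (simp add: inner_diff_left algebra_simps)
  qed
  have "f x \<noteq> \<infinity>" "f y \<noteq> \<infinity>" using a b by (simp_all add: subdifferential_iff[OF f(1)])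
  with growth[OF a, of y] growth[OF b, of x] show ?thesis
    by (simp add: norm_minus_commute inner_diff_left inner_diff_right)
qed

lemma prox_eq_iff:
  fixes f :: "'a::{real_inner, complete_space} \<Rightarrow> ereal"
  assumes f: "proper_fun f" "lower_semicontinuous f" "strongly_convex_ereal \<rho> f"
    and \<rho>: "\<rho> > 0" and \<beta>: "\<beta> > 0"
  shows "prox \<beta> f y = x \<longleftrightarrow> (1 / \<beta>) *\<^sub>R (y - x) \<in> subdifferential f x"
proof -
  define D where "D = {x. f x \<noteq> \<infinity>}"
  define G where "G z = real_of_ereal (f z) + 1 / (2 * \<beta>) * (norm (z - y))\<^sup>2" for z
  define m where "m = \<rho> + 1 / \<beta>"
  have fin: "f w = ereal (real_of_ereal (f w))" if "w \<in> D" for w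
    using that f(1) by (cases "f w") (auto simp: proper_fun_def D_def)
  have m: "m > 0" using \<rho> \<beta> by (simp add: m_def add_pos_pos)
  have sc: "closed_strongly_convex m D G"
    using closed_strongly_convex_add_quadratic[OF closed_strongly_convex_real_of_ereal[OF f],
        of "1 / (2 * \<beta>)" y 0] by (simp add: m_def D_def G_def[abs_def])
  obtain p where p: "p \<in> D" and min: "\<And>w. w \<in> D \<Longrightarrow> G p \<le> G w"
    using strongly_convex_minimizer_exists[OF sc m] by blast
  have growth: "G p + m / 2 * (norm (z - p))\<^sup>2 \<le> G z" if "z \<in> D" for z
    by (rule strongly_convex_minimizer_growth[OF sc p that min])
  have unique: "w = p" if w: "w \<in> D" "\<And>z. z \<in> D \<Longrightarrow> G w \<le> G z" for w
  proof -
    have "m / 2 * (norm (w - p))\<^sup>2 \<le> 0" using growth[OF w(1)] w(2)[OF p] by linarith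
    then show ?thesis using m by (simp add: mult_le_0_iff)
  qed
  have obj: "f z + ereal (1 / (2 * \<beta>) * (norm (z - y))\<^sup>2) = (if z \<in> D then ereal (G z) else \<infinity>)" for z
  proof (cases "z \<in> D")
    case True
    then show ?thesis by (subst fin) (simp_all add: G_def)
  qed (simp add: D_def)
  have "is_arg_min (\<lambda>z. f z + ereal (1 / (2 * \<beta>) * (norm (z - y))\<^sup>2)) (\<lambda>_. True) w \<longleftrightarrow>
      w \<in> D \<and> (\<forall>z\<in>D. G w \<le> G z)" for w
    unfolding obj is_arg_min_linorder using p by auto
  then have arg: "is_arg_min (\<lambda>z. f z + ereal (1 / (2 * \<beta>) * (norm (z - y))\<^sup>2)) (\<lambda>_. True) w \<longleftrightarrow> w = p" for w
    using unique p min by blast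
  \<comment> \<open>The choice inside \<open>arg_min\<close> is determined because
    \<open>arg\<close> reduces its predicate to equality with \<open>p\<close>.\<close>
  have prox: "prox \<beta> f y = p"
    unfolding prox_def arg_min_def arg by simp
  have expand: "1 / (2 * \<beta>) * (norm (z - y))\<^sup>2 = 1 / (2 * \<beta>) * (norm (x - y))\<^sup>2
      - inner (z - x) ((1 / \<beta>) *\<^sub>R (y - x)) + 1 / (2 * \<beta>) * (norm (z - x))\<^sup>2" for x z
  proof -
    have "z - y = (x - y) + (z - x)" by simp
    then have "(norm (z - y))\<^sup>2 = (norm (x - y))\<^sup>2 + 2 * inner (x - y) (z - x) + (norm (z - x))\<^sup>2"
      by (simp only: power2_norm_add)
    moreover have "inner (x - y) (z - x) = - inner (z - x) (y - x)"
      by (simp add: inner_diff_left inner_diff_right inner_commute)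
    moreover have "inner (z - x) ((1 / \<beta>) *\<^sub>R (y - x)) = inner (z - x) (y - x) / \<beta>" by simp
    ultimately show ?thesis using \<beta> by (simp only:) (simp add: field_simps)
  qed
  have sub: "(1 / \<beta>) *\<^sub>R (y - p) \<in> subdifferential f p"
    unfolding subdifferential_iff[OF f(1)]
  proof (intro conjI allI impI)
    show "f p \<noteq> \<infinity>" using p by (simp add: D_def)
    fix z assume "f z \<noteq> \<infinity>"
    then have "G p + m / 2 * (norm (z - p))\<^sup>2 \<le> G z" by (intro growth) (simp add: D_def)
    moreover have "m / 2 * (norm (z - p))\<^sup>2 = \<rho> / 2 * (norm (z - p))\<^sup>2 + 1 / (2 * \<beta>) * (norm (z - p))\<^sup>2"
      by (simp add: m_def field_simps)
    moreover have "0 \<le> \<rho> / 2 * (norm (z - p))\<^sup>2" using \<rho> by simp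
    ultimately show "real_of_ereal (f p) + inner (z - p) ((1 / \<beta>) *\<^sub>R (y - p)) \<le> real_of_ereal (f z)"
      unfolding G_def expand[of z p] by linarith
  qed
  have "x = p" if x: "(1 / \<beta>) *\<^sub>R (y - x) \<in> subdifferential f x"
  proof (rule unique)
    note s = x[unfolded subdifferential_iff[OF f(1)]]
    show "x \<in> D" using s by (simp add: D_def)
    fix z assume "z \<in> D"
    then have "real_of_ereal (f x) + inner (z - x) ((1 / \<beta>) *\<^sub>R (y - x)) \<le> real_of_ereal (f z)"
      using s by (simp add: D_def)
    moreover have "0 \<le> 1 / (2 * \<beta>) * (norm (z - x))\<^sup>2" using \<beta> by simp
    ultimately show "G x \<le> G z" unfolding G_def expand[of z x] by linarith
  qed
  with sub prox show ?thesis by blast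
qed

text \<open>Strong monotonicity of the subdifferential, read through the subgradients
  \<open>(1 / \<beta>) *\<^sub>R (z - prox \<beta> f z)\<close>. It strengthens the firm
  nonexpansiveness of the proximal map.\<close>

lemma prox_strongly_monotone:
  fixes f :: "'a::{real_inner, complete_space} \<Rightarrow> ereal"
  assumes f: "proper_fun f" "lower_semicontinuous f" "strongly_convex_ereal \<rho> f"
    and \<rho>: "\<rho> > 0" and \<beta>: "\<beta> > 0"
  shows "\<beta> * \<rho> * (norm (prox \<beta> f y - prox \<beta> f w))\<^sup>2
    \<le> inner (prox \<beta> f y - prox \<beta> f w) ((y - w) - (prox \<beta> f y - prox \<beta> f w))"
proof -
  let ?p = "prox \<beta> f"
  have "(1 / \<beta>) *\<^sub>R (z - ?p z) \<in> subdifferential f (?p z)" for z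
    using prox_eq_iff[OF f \<rho> \<beta>] by blast
  then have "\<rho> * (norm (?p y - ?p w))\<^sup>2
      \<le> inner (?p y - ?p w) ((1 / \<beta>) *\<^sub>R (y - ?p y) - (1 / \<beta>) *\<^sub>R (w - ?p w))"
    by (intro subdifferential_strongly_monotone[OF f])
  also have "(1 / \<beta>) *\<^sub>R (y - ?p y) - (1 / \<beta>) *\<^sub>R (w - ?p w) = (1 / \<beta>) *\<^sub>R ((y - w) - (?p y - ?p w))"
    by (simp add: algebra_simps)
  also have "inner (?p y - ?p w) \<dots> = inner (?p y - ?p w) ((y - w) - (?p y - ?p w)) / \<beta>" by simp
  finally show ?thesis using \<beta> by (simp only: pos_le_divide_eq mult_ac)
qed

section \<open>The three-operator splitting map and its fixed points\<close>

text \<open>This is the Davis-Yin splitting map; its forward step carries a plus sign because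
  \<open>h\<close> is subtracted in the objective.\<close>

definition three_operator ::
    "real \<Rightarrow> ('a::real_inner \<Rightarrow> ereal) \<Rightarrow> ('a \<Rightarrow> ereal) \<Rightarrow> ('a \<Rightarrow> 'a) \<Rightarrow> 'a \<Rightarrow> 'a" where
  "three_operator \<beta> f g dh w =
    w + (prox \<beta> g (2 *\<^sub>R prox \<beta> f w - w + \<beta> *\<^sub>R dh (prox \<beta> f w)) - prox \<beta> f w)"

text \<open>The two proximal inequalities are added. The gradient cross term is at most
  \<open>\<beta> * L / 2\<close> times \<open>(norm Y)\<^sup>2 + (norm Z)\<^sup>2\<close>, which the
  strong monotonicity terms absorb when \<open>L \<le> 2 * \<rho>\<close>. Both sides scale with
  \<open>\<beta>\<close>, so no bound on the step size arises.\<close>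

lemma three_operator_firmly_nonexpansive:
  fixes f g :: "'a::{real_inner, complete_space} \<Rightarrow> ereal"
  assumes f: "proper_fun f" "lower_semicontinuous f" "strongly_convex_ereal \<rho> f"
    and g: "proper_fun g" "lower_semicontinuous g" "strongly_convex_ereal \<rho> g"
    and \<rho>: "\<rho> > 0" and \<beta>: "\<beta> > 0" and lip: "L-lipschitz_on UNIV dh" and L: "L \<le> 2 * \<rho>"
  defines "T \<equiv> three_operator \<beta> f g dh"
  shows "(norm (T p - T q))\<^sup>2 + (norm ((T p - p) - (T q - q)))\<^sup>2 \<le> (norm (p - q))\<^sup>2"
proof -
  define P where "P = prox \<beta> f"
  define R where "R w = 2 *\<^sub>R P w - w + \<beta> *\<^sub>R dh (P w)" for w
  define U Y Z where "U = p - q" and "Y = P p - P q" and "Z = prox \<beta> g (R p) - prox \<beta> g (R q)"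
  define V where "V = dh (P p) - dh (P q)"
  have T: "T w = w + (prox \<beta> g (R w) - P w)" for w
    by (simp add: T_def three_operator_def R_def P_def)
  have Y: "\<beta> * \<rho> * (norm Y)\<^sup>2 \<le> inner Y (U - Y)"
    unfolding Y_def U_def P_def by (rule prox_strongly_monotone[OF f \<rho> \<beta>])
  have "R p - R q = 2 *\<^sub>R Y - U + \<beta> *\<^sub>R V"
    by (simp add: R_def Y_def U_def V_def algebra_simps scaleR_2)
  then have Z: "\<beta> * \<rho> * (norm Z)\<^sup>2 \<le> inner Z (2 *\<^sub>R Y - U + \<beta> *\<^sub>R V - Z)"
    using prox_strongly_monotone[OF g \<rho> \<beta>, of "R p" "R q"] by (simp add: Z_def)
  have V: "norm V \<le> L * norm Y"
    using lipschitz_onD[OF lip, of "P p" "P q"] by (simp add: V_def Y_def dist_norm)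
  have "inner Z V \<le> norm Z * norm V" by (rule norm_cauchy_schwarz)
  also have "\<dots> \<le> norm Z * (L * norm Y)" using V by (intro mult_left_mono) auto
  also have "\<dots> = L * (norm Z * norm Y)" by simp
  also have "\<dots> \<le> L * (((norm Y)\<^sup>2 + (norm Z)\<^sup>2) / 2)"
    using lipschitz_on_nonneg[OF lip] sum_squares_bound[of "norm Z" "norm Y"] by (intro mult_left_mono) auto
  also have "\<dots> \<le> (2 * \<rho>) * (((norm Y)\<^sup>2 + (norm Z)\<^sup>2) / 2)" using L by (intro mult_right_mono) auto
  finally have "inner Z V \<le> \<rho> * (norm Y)\<^sup>2 + \<rho> * (norm Z)\<^sup>2" by (simp add: algebra_simps)
  then have ZV: "\<beta> * inner Z V \<le> \<beta> * \<rho> * (norm Y)\<^sup>2 + \<beta> * \<rho> * (norm Z)\<^sup>2"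
    using mult_left_mono[of "inner Z V" "\<rho> * (norm Y)\<^sup>2 + \<rho> * (norm Z)\<^sup>2" \<beta>] \<beta> by (simp add: distrib_left)
  have "inner Y (U - Y) + inner Z (2 *\<^sub>R Y - U + \<beta> *\<^sub>R V - Z)
      = \<beta> * inner Z V - (inner U (Z - Y) + (norm (Z - Y))\<^sup>2)"
    by (simp add: power2_norm_eq_inner inner_diff_left inner_diff_right inner_add_right inner_commute)
  then have "inner U (Z - Y) + (norm (Z - Y))\<^sup>2 \<le> 0" using Y Z ZV by linarith
  \<comment> \<open>Expanding the square shows that this is the previous inequality doubled.\<close>
  then have "(norm (U + (Z - Y)))\<^sup>2 + (norm (Z - Y))\<^sup>2 \<le> (norm U)\<^sup>2"
    unfolding power2_norm_add by linarith
  moreover have "T p - T q = U + (Z - Y)" "(T p - p) - (T q - q) = Z - Y"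
    by (simp_all add: T U_def Y_def Z_def)
  ultimately show ?thesis by (simp only: U_def)
qed

text \<open>A fixed point makes the two proximal points agree; adding their optimality conditions
  cancels \<open>w\<close> and leaves \<open>A + B = dh x\<close>, which is the stationarity that
  \<open>Gamma_set\<close> demands.\<close>

lemma Gamma_set_eq_fixed_points:
  fixes f g :: "'a::{real_inner, complete_space} \<Rightarrow> ereal"
  assumes f: "proper_fun f" "lower_semicontinuous f" "strongly_convex_ereal \<rho> f"
    and g: "proper_fun g" "lower_semicontinuous g" "strongly_convex_ereal \<rho> g"
    and \<rho>: "\<rho> > 0" and \<beta>: "\<beta> > 0"
  shows "Gamma_set \<beta> f g dh = {w. three_operator \<beta> f g dh w = w}"
proof (intro set_eqI iffI)
  fix w assume "w \<in> Gamma_set \<beta> f g dh"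
  then show "w \<in> {w. three_operator \<beta> f g dh w = w}" by (auto simp: Gamma_set_def three_operator_def)
next
  fix w assume w: "w \<in> {w. three_operator \<beta> f g dh w = w}"
  define x where "x = prox \<beta> f w"
  have g_fix: "prox \<beta> g (2 *\<^sub>R x - w + \<beta> *\<^sub>R dh x) = x" using w by (simp add: three_operator_def x_def)
  define A B where "A = (1 / \<beta>) *\<^sub>R (w - x)" and "B = (1 / \<beta>) *\<^sub>R (2 *\<^sub>R x - w + \<beta> *\<^sub>R dh x - x)"
  have "A \<in> subdifferential f x" unfolding A_def using prox_eq_iff[OF f \<rho> \<beta>] x_def by blast
  moreover have "B \<in> subdifferential g x" unfolding B_def using prox_eq_iff[OF g \<rho> \<beta>] g_fix by blast
  moreover have "A + B - dh x = 0" using \<beta> by (simp add: A_def B_def algebra_simps scaleR_2)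
  ultimately have "x \<in> stationary_points f g dh" unfolding stationary_points_def by force
  with g_fix show "w \<in> Gamma_set \<beta> f g dh" unfolding Gamma_set_def x_def by blast
qed

lemma Gamma_set_nonempty:
  fixes f g :: "'a::{real_inner, complete_space} \<Rightarrow> ereal"
  assumes f: "proper_fun f" "lower_semicontinuous f" "strongly_convex_ereal \<rho> f"
    and g: "proper_fun g" "lower_semicontinuous g" "strongly_convex_ereal \<rho> g"
    and \<rho>: "\<rho> > 0" and \<beta>: "\<beta> > 0" and ne: "stationary_points f g dh \<noteq> {}"
  shows "Gamma_set \<beta> f g dh \<noteq> {}"
proof -
  obtain x A B where x: "x \<in> stationary_points f g dh" and A: "A \<in> subdifferential f x"
    and B: "B \<in> subdifferential g x" and "0 = A + B - dh x"
    using ne unfolding stationary_points_def by blast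
  then have h: "dh x = A + B" by simp
  \<comment> \<open>The witness is \<open>x + \<beta> *\<^sub>R A\<close>: its proximal residual for
    \<open>f\<close> is \<open>A\<close>, and stationarity makes the reflected point have residual
    \<open>B\<close> for \<open>g\<close>.\<close>
  have "(1 / \<beta>) *\<^sub>R ((x + \<beta> *\<^sub>R A) - x) = A"
    and "(1 / \<beta>) *\<^sub>R ((2 *\<^sub>R x - (x + \<beta> *\<^sub>R A) + \<beta> *\<^sub>R dh x) - x) = B"
    using \<beta> by (simp_all add: h algebra_simps scaleR_2)
  then have "prox \<beta> f (x + \<beta> *\<^sub>R A) = x" "prox \<beta> g (2 *\<^sub>R x - (x + \<beta> *\<^sub>R A) + \<beta> *\<^sub>R dh x) = x"
    using A B by (simp_all only: prox_eq_iff[OF f \<rho> \<beta>] prox_eq_iff[OF g \<rho> \<beta>])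
  then show ?thesis using x unfolding Gamma_set_def by blast
qed

theorem theorem3p3:
  fixes f g :: "'a::{real_inner, complete_space} \<Rightarrow> ereal"
    and h :: "'a \<Rightarrow> real" and dh :: "'a \<Rightarrow> 'a"
    and \<rho> L \<beta> \<theta> a b :: real
    and \<kappa> :: "nat \<Rightarrow> real"
    and x v u y z :: "nat \<Rightarrow> 'a"
  assumes "\<rho> > 0" and "L > 0" and "\<beta> > 0" and "\<theta> \<ge> 0"
    and "proper_fun f" and "lower_semicontinuous f" and "strongly_convex_ereal \<rho> f"
    and "proper_fun g" and "lower_semicontinuous g" and "strongly_convex_ereal \<rho> g"
    and "convex_on UNIV h"
    and "\<And>w. GDERIV h w :> dh w"
    and "L-lipschitz_on UNIV dh"
    and "stationary_points f g dh \<noteq> {}"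
    and "2 * \<rho> > L"
    and "0 < a" and "\<And>n. a \<le> \<kappa> n" and "\<And>n. \<kappa> n \<le> b" and "b < 2"
    and "\<And>n. u n = (1 / (1 + \<theta>)) *\<^sub>R x n + (\<theta> / (1 + \<theta>)) *\<^sub>R v n"
    and "\<And>n. y n = prox \<beta> f (u n)"
    and "\<And>n. z n = prox \<beta> g (2 *\<^sub>R y n - u n + \<beta> *\<^sub>R dh (y n))"
    and "\<And>n. x (Suc n) = u n + \<kappa> n *\<^sub>R (z n - y n)"
    and "\<And>n. v (Suc n) = (1 / (1 + \<theta>)) *\<^sub>R x (Suc n) + (\<theta> / (1 + \<theta>)) *\<^sub>R v n"
  shows "\<exists>p\<in>Gamma_set \<beta> f g dh. weakly_converges_to x p"
proof -
  let ?T = "three_operator \<beta> f g dh"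
  note \<rho> = assms(1) and \<beta> = assms(3) and \<theta> = assms(4) and f = assms(5-7) and g = assms(8-10)
  note Gamma = Gamma_set_eq_fixed_points[OF f g \<rho> \<beta>, of dh]
  obtain p0 where p0: "?T p0 = p0"
    using Gamma_set_nonempty[OF f g \<rho> \<beta> assms(14)] unfolding Gamma by blast
  have step: "x (Suc n) = u n + \<kappa> n *\<^sub>R (?T (u n) - u n)" for n
    using assms(21-23)[of n] by (simp add: three_operator_def)
  have firm: "(norm (?T p - ?T q))\<^sup>2 + (norm ((?T p - p) - (?T q - q)))\<^sup>2 \<le> (norm (p - q))\<^sup>2" for p q
    by (rule three_operator_firmly_nonexpansive[OF f g \<rho> \<beta> assms(13) less_imp_le[OF assms(15)]])
  have "\<exists>p. ?T p = p \<and> weakly_converges_to x p"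
    by (rule inertial_krasnoselskii_mann[where T = ?T and u = u and x = x and v = v and \<kappa> = \<kappa>,
          OF firm p0 \<theta> assms(16-20) step assms(24)])
  then show ?thesis unfolding Gamma by blast
qed

end
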